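(* Let $p,q\ge 0$ be integers with $n=p+q$, and let $\mu\in C\ell_{p,q}$ satisfy $\mu^2=-1$. Let $f_X$ and $g_X$ be two $C\ell_{p,q}$-valued Clifford algebra probability density functions on $\mathbb{R}$, with characteristic functions $$\phi_X(t)=\int_{\mathbb{R}} f_X(x)e^{\mu t x}\,dx,\qquad \psi_X(x)=\int_{\mathbb{R}} g_X(t)e^{\mu t x}\,dt .$$ Then for every $y\in\mathbb{R}$, $$\int_{\mathbb{R}} g_X(t)\,\phi_X(t)\,e^{-\mu t y}\,dt=\sum_{\Sigma\subseteq\{1,\dots,n\}} e_\Sigma\,\big(f_X*(\psi_X)^{\lozenge}_\Sigma\big)(y),$$ where $(\psi_X)^{\lozenge}_\Sigma(x)=(\psi_X)_\Sigma(-x)$.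
   Context: $C\ell_{p,q}$ is the real associative Clifford algebra generated by $e_1,\dots,e_n$ ($n=p+q$) subject to $e_\ell e_k+e_k e_\ell=2\delta_{\ell,k}\varepsilon_\ell$, where $\varepsilon_\ell=1$ for $1\le\ell\le p$ and $\varepsilon_\ell=-1$ for $p+1\le\ell\le n$. It has real dimension $2^n$ with basis $e_\Sigma=e_{\sigma_1}\cdots e_{\sigma_\ell}$, for $\Sigma=\{\sigma_1<\dots<\sigma_\ell\}\subseteq\{1,\dots,n\}$, and $e_\emptyset=1$. Integrals of $C\ell_{p,q}$-valued functions are taken coefficientwise. For $\mu\in C\ell_{p,q}$ with $\mu^2=-1$ and $\theta\in\mathbb{R}$, $e^{\mu\theta}=\cos\theta+\mu\sin\theta$. A Clifford algebra probability density function (of a real random variable $X$) is a function $f_X=\sum_{\Sigma\subseteq\{1,\dots,n\}} e_\Sigma (f_X)_\Sigma:\mathbb{R}\to C\ell_{p,q}$ such that each real-valued coefficient function $(f_X)_\Sigma$ is an ordinary probability density, i.e. measurable, nonnegative, with $\int_{\mathbb{R}}(f_X)_\Sigma(x)\,dx=1$. The subscript $X$ is only a label here. The components of a characteristic function are the transforms of the real coefficients of the density: for $\psi_X$ obtained from $g_X=\sum_\Sigma e_\Sigma (g_X)_\Sigma$, one sets $(\psi_X)_\Sigma(x)=\int_{\mathbb{R}}(g_X)_\Sigma(t)e^{\mu t x}\,dt$, which takes values in $\mathrm{span}_{\mathbb{R}}\{1,\mu\}$, so that $\psi_X=\sum_\Sigma e_\Sigma(\psi_X)_\Sigma$. (These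 are not the real coordinates of $\psi_X$ in the basis $(e_\Sigma)$.) Convolution is $(f*h)(y)=\int_{\mathbb{R}} f(x)h(y-x)\,dx$, with the product taken in $C\ell_{p,q}$ in this order. *)

theory Defs
  imports "HOL-Analysis.Analysis" "HOL-Algebra.Module"
begin

section \<open>The real Clifford algebra of signature (p, q)\<close>

text \<open>
  A multivector is given by its real coordinates with respect to the basis of ordered products
  of generators, indexed by subsets of \<open>{1..p + q}\<close>; the coordinate at any other index is zero.
\<close>

type_synonym multivector = "nat set \<Rightarrow> real"

definition clifford_eps :: "nat \<Rightarrow> nat \<Rightarrow> real" where
  "clifford_eps p l = (if l \<le> p then 1 else - 1)"

text \<open>
  The sign in the product of two basis elements: each generator of the right factor is moved
  leftwards to its place; it anticommutes with every larger generator of the left factor that it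
  passes, and contracts to its square with an equal one.
\<close>

definition clifford_sign :: "nat \<Rightarrow> nat set \<Rightarrow> nat set \<Rightarrow> real" where
  "clifford_sign p A B =
     (\<Prod>i\<in>A. \<Prod>j\<in>B. if j < i then - 1 else if i = j then clifford_eps p i else 1)"

definition clifford :: "nat \<Rightarrow> nat \<Rightarrow> (real, multivector) module" where
  "clifford p q =
     \<lparr>carrier = {a. \<forall>S. \<not> S \<subseteq> {1..p + q} \<longrightarrow> a S = 0},
      monoid.mult = (\<lambda>a b S. \<Sum>A\<in>Pow {1..p + q}. \<Sum>B\<in>Pow {1..p + q}.
        if sym_diff A B = S then clifford_sign p A B * a A * b B else 0),
      one = (\<lambda>S. if S = {} then 1 else 0),
      zero = (\<lambda>S. 0),
      add = (\<lambda>a b S. a S + b S),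
      smult = (\<lambda>r a S. r * a S)\<rparr>"

definition clifford_gen :: "nat \<Rightarrow> multivector" where
  "clifford_gen k = (\<lambda>S. if S = {k} then 1 else 0)"

text \<open>The ordered product of the generators with index in \<open>S\<close>.\<close>

definition clifford_basis :: "nat \<Rightarrow> nat \<Rightarrow> nat set \<Rightarrow> multivector" where
  "clifford_basis p q S =
     foldr (\<lambda>k a. clifford_gen k \<otimes>\<^bsub>clifford p q\<^esub> a) (sorted_list_of_set S) \<one>\<^bsub>clifford p q\<^esub>"

text \<open>
  The following facts identify the concrete structure with the algebra given by generators and
  relations: it is an associative unital real algebra, the generators satisfy the Clifford
  relations, and their ordered products are the coordinate basis.
\<close>

lemma clifford_simps:
  "a \<in> carrier (clifford p q) \<longleftrightarrow> (\<forall>S. \<not> S \<subseteq> {1..p + q} \<longrightarrow> a S = 0)"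
  "(a \<otimes>\<^bsub>clifford p q\<^esub> b) S = (\<Sum>A\<in>Pow {1..p + q}. \<Sum>B\<in>Pow {1..p + q}.
     if sym_diff A B = S then clifford_sign p A B * a A * b B else 0)"
  "\<one>\<^bsub>clifford p q\<^esub> = (\<lambda>S. if S = {} then 1 else 0)"
  "\<zero>\<^bsub>clifford p q\<^esub> = (\<lambda>S. 0)"
  "a \<oplus>\<^bsub>clifford p q\<^esub> b = (\<lambda>S. a S + b S)"
  "r \<odot>\<^bsub>clifford p q\<^esub> a = (\<lambda>S. r * a S)"
  by (simp_all add: clifford_def)

lemma prod_sym_diff_unit:
  fixes c :: "'a \<Rightarrow> real"
  assumes "finite A" "finite B" "\<And>i. c i * c i = 1"
  shows "prod c (sym_diff A B) = prod c A * prod c B"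
proof -
  have 1: "prod c (A \<inter> B) * prod c (A \<inter> B) = 1"
    by (simp add: assms prod.distrib [symmetric])
  have A: "prod c A = prod c (A - B) * prod c (A \<inter> B)"
    using assms(1) by (metis Int_Diff_Un Int_Diff_disjoint finite_Diff finite_Int prod.union_disjoint mult.commute)
  have B: "prod c B = prod c (B - A) * prod c (A \<inter> B)"
    using assms(2) by (metis Int_Diff_Un Int_Diff_disjoint finite_Diff finite_Int prod.union_disjoint mult.commute Int_commute)
  have "prod c (sym_diff A B) = prod c (A - B) * prod c (B - A)"
    using assms by (intro prod.union_disjoint) auto
  also have "\<dots> = prod c (A - B) * prod c (B - A) * (prod c (A \<inter> B) * prod c (A \<inter> B))"
    by (simp only: 1 mult_1_right)
  finally show ?thesis unfolding A B by (simp only: ac_simps)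
qed

lemma clifford_sign_sym_diff_right:
  assumes "finite B" "finite C"
  shows "clifford_sign p A (sym_diff B C) = clifford_sign p A B * clifford_sign p A C"
  unfolding clifford_sign_def prod.distrib [symmetric]
  by (intro prod.cong refl prod_sym_diff_unit assms) (auto simp: clifford_eps_def)

lemma clifford_sign_sym_diff_left:
  assumes "finite A" "finite B"
  shows "clifford_sign p (sym_diff A B) C = clifford_sign p A C * clifford_sign p B C"
  unfolding clifford_sign_def
  by (intro prod_sym_diff_unit assms)
     (auto simp: prod.distrib [symmetric] clifford_eps_def intro!: prod.neutral)

lemma sum_rotate4:
  fixes F :: "'a \<Rightarrow> 'a \<Rightarrow> 'a \<Rightarrow> 'a \<Rightarrow> real"
  shows "(\<Sum>d\<in>P. \<Sum>c\<in>P. \<Sum>a\<in>P. \<Sum>b\<in>P. F a b c d) = (\<Sum>a\<in>P. \<Sum>b\<in>P. \<Sum>c\<in>P. \<Sum>d\<in>P. F a b c d)"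
proof -
  have "(\<Sum>d\<in>P. \<Sum>c\<in>P. \<Sum>a\<in>P. \<Sum>b\<in>P. F a b c d) = (\<Sum>c\<in>P. \<Sum>d\<in>P. \<Sum>a\<in>P. \<Sum>b\<in>P. F a b c d)"
    by (rule sum.swap)
  also have "\<dots> = (\<Sum>c\<in>P. \<Sum>a\<in>P. \<Sum>d\<in>P. \<Sum>b\<in>P. F a b c d)"
    by (rule sum.cong [OF refl], rule sum.swap)
  also have "\<dots> = (\<Sum>a\<in>P. \<Sum>c\<in>P. \<Sum>d\<in>P. \<Sum>b\<in>P. F a b c d)"
    by (rule sum.swap)
  also have "\<dots> = (\<Sum>a\<in>P. \<Sum>c\<in>P. \<Sum>b\<in>P. \<Sum>d\<in>P. F a b c d)"
    by (rule sum.cong [OF refl], rule sum.cong [OF refl], rule sum.swap)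
  also have "\<dots> = (\<Sum>a\<in>P. \<Sum>b\<in>P. \<Sum>c\<in>P. \<Sum>d\<in>P. F a b c d)"
    by (rule sum.cong [OF refl], rule sum.swap)
  finally show ?thesis .
qed

lemma clifford_mult_assoc:
  "(a \<otimes>\<^bsub>clifford p q\<^esub> b) \<otimes>\<^bsub>clifford p q\<^esub> c = a \<otimes>\<^bsub>clifford p q\<^esub> (b \<otimes>\<^bsub>clifford p q\<^esub> c)"
proof
  fix S
  let ?P = "Pow {1..p + q}"
  let ?s = "clifford_sign p"
  have fin: "finite A" if "A \<in> ?P" for A
    using that finite_subset by auto
  have "((a \<otimes>\<^bsub>clifford p q\<^esub> b) \<otimes>\<^bsub>clifford p q\<^esub> c) S =
    (\<Sum>D\<in>?P. \<Sum>C\<in>?P. \<Sum>A\<in>?P. \<Sum>B\<in>?P. if D = sym_diff A B then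
       (if sym_diff D C = S then ?s D C * (?s A B * a A * b B) * c C else 0) else 0)"
    unfolding clifford_simps
  proof (intro sum.cong refl)
    fix D C
    show "(if sym_diff D C = S then ?s D C * (\<Sum>A\<in>?P. \<Sum>B\<in>?P.
          if sym_diff A B = D then ?s A B * a A * b B else 0) * c C else 0) =
      (\<Sum>A\<in>?P. \<Sum>B\<in>?P. if D = sym_diff A B then
         (if sym_diff D C = S then ?s D C * (?s A B * a A * b B) * c C else 0) else 0)"
    proof (cases "sym_diff D C = S")
      case True
      then show ?thesis
        by (auto simp: sum_distrib_left sum_distrib_right intro!: sum.cong)
    next
      case False
      then show ?thesis by (simp only: if_False if_cancel sum.neutral_const)
    qed
  qed
  also have "\<dots> = (\<Sum>A\<in>?P. \<Sum>B\<in>?P. \<Sum>C\<in>?P. \<Sum>D\<in>?P. if D = sym_diff A B then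
       (if sym_diff D C = S then ?s D C * (?s A B * a A * b B) * c C else 0) else 0)"
    by (rule sum_rotate4)
  also have "\<dots> = (\<Sum>A\<in>?P. \<Sum>B\<in>?P. \<Sum>C\<in>?P.
       if sym_diff (sym_diff A B) C = S then ?s A B * ?s A C * ?s B C * a A * b B * c C else 0)"
  proof (intro sum.cong refl)
    fix A B C assume *: "A \<in> ?P" "B \<in> ?P" "C \<in> ?P"
    then have "sym_diff A B \<in> ?P" by auto
    then show "(\<Sum>D\<in>?P. if D = sym_diff A B then
       (if sym_diff D C = S then ?s D C * (?s A B * a A * b B) * c C else 0) else 0) =
       (if sym_diff (sym_diff A B) C = S then ?s A B * ?s A C * ?s B C * a A * b B * c C else 0)"
      by (subst sum.delta) (simp_all add: clifford_sign_sym_diff_left [OF fin [OF *(1)] fin [OF *(2)]] del: Pow_iff)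
  qed
  also have "\<dots> = (\<Sum>A\<in>?P. \<Sum>B\<in>?P. \<Sum>C\<in>?P. \<Sum>D\<in>?P. if D = sym_diff B C then
       (if sym_diff A D = S then ?s A D * a A * (?s B C * b B * c C) else 0) else 0)"
  proof (intro sum.cong refl)
    fix A B C assume *: "A \<in> ?P" "B \<in> ?P" "C \<in> ?P"
    then have "sym_diff B C \<in> ?P" by auto
    moreover have "sym_diff (sym_diff A B) C = sym_diff A (sym_diff B C)" by blast
    ultimately show "(if sym_diff (sym_diff A B) C = S
         then ?s A B * ?s A C * ?s B C * a A * b B * c C else 0) =
       (\<Sum>D\<in>?P. if D = sym_diff B C then
       (if sym_diff A D = S then ?s A D * a A * (?s B C * b B * c C) else 0) else 0)"
      by (subst sum.delta) (simp_all add: clifford_sign_sym_diff_right [OF fin [OF *(2)] fin [OF *(3)]] del: Pow_iff)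
  qed
  also have "\<dots> = (\<Sum>A\<in>?P. \<Sum>D\<in>?P. \<Sum>B\<in>?P. \<Sum>C\<in>?P. if D = sym_diff B C then
       (if sym_diff A D = S then ?s A D * a A * (?s B C * b B * c C) else 0) else 0)"
  proof (rule sum.cong [OF refl])
    fix A
    let ?F = "\<lambda>B C D. if D = sym_diff B C then
       (if sym_diff A D = S then ?s A D * a A * (?s B C * b B * c C) else 0) else 0"
    have "(\<Sum>B\<in>?P. \<Sum>C\<in>?P. \<Sum>D\<in>?P. ?F B C D) = (\<Sum>B\<in>?P. \<Sum>D\<in>?P. \<Sum>C\<in>?P. ?F B C D)"
      by (rule sum.cong [OF refl], rule sum.swap)
    also have "\<dots> = (\<Sum>D\<in>?P. \<Sum>B\<in>?P. \<Sum>C\<in>?P. ?F B C D)"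
      by (rule sum.swap)
    finally show "(\<Sum>B\<in>?P. \<Sum>C\<in>?P. \<Sum>D\<in>?P. ?F B C D) = (\<Sum>D\<in>?P. \<Sum>B\<in>?P. \<Sum>C\<in>?P. ?F B C D)" .
  qed
  also have "\<dots> = (a \<otimes>\<^bsub>clifford p q\<^esub> (b \<otimes>\<^bsub>clifford p q\<^esub> c)) S"
    unfolding clifford_simps
  proof (intro sum.cong refl)
    fix A D
    show "(\<Sum>B\<in>?P. \<Sum>C\<in>?P. if D = sym_diff B C then
         (if sym_diff A D = S then ?s A D * a A * (?s B C * b B * c C) else 0) else 0) =
      (if sym_diff A D = S then ?s A D * a A * (\<Sum>B\<in>?P. \<Sum>C\<in>?P.
          if sym_diff B C = D then ?s B C * b B * c C else 0) else 0)"
    proof (cases "sym_diff A D = S")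
      case True
      then show ?thesis
        by (auto simp: sum_distrib_left sum_distrib_right intro!: sum.cong)
    next
      case False
      then show ?thesis by (simp only: if_False if_cancel sum.neutral_const)
    qed
  qed
  finally show "((a \<otimes>\<^bsub>clifford p q\<^esub> b) \<otimes>\<^bsub>clifford p q\<^esub> c) S =
    (a \<otimes>\<^bsub>clifford p q\<^esub> (b \<otimes>\<^bsub>clifford p q\<^esub> c)) S" .
qed

lemma clifford_mult_indicator:
  assumes "A \<subseteq> {1..p + q}" "B \<subseteq> {1..p + q}"
  shows "(\<lambda>S. if S = A then 1 else 0) \<otimes>\<^bsub>clifford p q\<^esub> (\<lambda>S. if S = B then 1 else 0) =
    (\<lambda>S. if S = sym_diff A B then clifford_sign p A B else 0)"
proof
  fix S
  have "((\<lambda>S. if S = A then 1 else 0) \<otimes>\<^bsub>clifford p q\<^esub> (\<lambda>S. if S = B then 1 else 0)) S =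
    (\<Sum>A'\<in>Pow {1..p + q}. \<Sum>B'\<in>Pow {1..p + q}. if B' = B then (if A' = A then
       (if S = sym_diff A B then clifford_sign p A B else 0) else 0) else 0)"
    unfolding clifford_simps by (intro sum.cong refl) auto
  then show "((\<lambda>S. if S = A then 1 else 0) \<otimes>\<^bsub>clifford p q\<^esub> (\<lambda>S. if S = B then 1 else 0)) S =
    (if S = sym_diff A B then clifford_sign p A B else 0)"
    using assms by (simp add: sum.delta del: Un_iff)
qed

lemma clifford_one_mult:
  assumes "a \<in> carrier (clifford p q)"
  shows "\<one>\<^bsub>clifford p q\<^esub> \<otimes>\<^bsub>clifford p q\<^esub> a = a"
proof
  fix S
  have "(\<one>\<^bsub>clifford p q\<^esub> \<otimes>\<^bsub>clifford p q\<^esub> a) S =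
    (\<Sum>A\<in>Pow {1..p + q}. \<Sum>B\<in>Pow {1..p + q}. if B = S then
       (if A = {} then clifford_sign p {} S * a S else 0) else 0)"
    unfolding clifford_simps by (intro sum.cong refl) auto
  then show "(\<one>\<^bsub>clifford p q\<^esub> \<otimes>\<^bsub>clifford p q\<^esub> a) S = a S"
    using assms
    by (cases "S \<subseteq> {1..p + q}") (simp_all add: sum.delta clifford_simps clifford_sign_def)
qed

lemma clifford_mult_one:
  assumes "a \<in> carrier (clifford p q)"
  shows "a \<otimes>\<^bsub>clifford p q\<^esub> \<one>\<^bsub>clifford p q\<^esub> = a"
proof
  fix S
  have "(a \<otimes>\<^bsub>clifford p q\<^esub> \<one>\<^bsub>clifford p q\<^esub>) S =
    (\<Sum>A\<in>Pow {1..p + q}. \<Sum>B\<in>Pow {1..p + q}. if B = {} then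
       (if A = S then clifford_sign p S {} * a S else 0) else 0)"
    unfolding clifford_simps by (intro sum.cong refl) auto
  then show "(a \<otimes>\<^bsub>clifford p q\<^esub> \<one>\<^bsub>clifford p q\<^esub>) S = a S"
    using assms by (simp add: sum.delta clifford_simps clifford_sign_def)
qed

lemma clifford_mult_closed:
  "a \<otimes>\<^bsub>clifford p q\<^esub> b \<in> carrier (clifford p q)"
proof -
  have "(a \<otimes>\<^bsub>clifford p q\<^esub> b) S = 0" if "\<not> S \<subseteq> {1..p + q}" for S
    unfolding clifford_simps using that by (intro sum.neutral ballI) auto
  then show ?thesis by (simp add: clifford_simps(1))
qed

lemma clifford_add_mult:
  "(a \<oplus>\<^bsub>clifford p q\<^esub> b) \<otimes>\<^bsub>clifford p q\<^esub> c =
     a \<otimes>\<^bsub>clifford p q\<^esub> c \<oplus>\<^bsub>clifford p q\<^esub> b \<otimes>\<^bsub>clifford p q\<^esub> c"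
  by (rule ext)
     (auto simp: clifford_simps sum.distrib [symmetric] algebra_simps intro!: sum.cong)

lemma clifford_mult_add:
  "c \<otimes>\<^bsub>clifford p q\<^esub> (a \<oplus>\<^bsub>clifford p q\<^esub> b) =
     c \<otimes>\<^bsub>clifford p q\<^esub> a \<oplus>\<^bsub>clifford p q\<^esub> c \<otimes>\<^bsub>clifford p q\<^esub> b"
  by (rule ext)
     (auto simp: clifford_simps sum.distrib [symmetric] algebra_simps intro!: sum.cong)

lemma clifford_smult_mult:
  "(r \<odot>\<^bsub>clifford p q\<^esub> a) \<otimes>\<^bsub>clifford p q\<^esub> b = r \<odot>\<^bsub>clifford p q\<^esub> (a \<otimes>\<^bsub>clifford p q\<^esub> b)"
  by (rule ext) (auto simp: clifford_simps sum_distrib_left intro!: sum.cong)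

lemma clifford_mult_smult:
  "a \<otimes>\<^bsub>clifford p q\<^esub> (r \<odot>\<^bsub>clifford p q\<^esub> b) = r \<odot>\<^bsub>clifford p q\<^esub> (a \<otimes>\<^bsub>clifford p q\<^esub> b)"
  by (rule ext) (auto simp: clifford_simps sum_distrib_left intro!: sum.cong)

lemma clifford_ring: "ring (clifford p q)"
proof (rule ringI)
  show "abelian_group (clifford p q)"
  proof (rule abelian_groupI)
    fix a assume "a \<in> carrier (clifford p q)"
    then show "\<exists>b\<in>carrier (clifford p q). b \<oplus>\<^bsub>clifford p q\<^esub> a = \<zero>\<^bsub>clifford p q\<^esub>"
      by (intro bexI [of _ "\<lambda>S. - a S"]) (auto simp: clifford_simps)
  qed (auto simp: clifford_simps algebra_simps)
  show "Group.monoid (clifford p q)"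
    by (rule monoidI)
       (simp_all add: clifford_mult_closed clifford_mult_assoc clifford_one_mult clifford_mult_one,
        simp add: clifford_simps)
qed (simp_all add: clifford_add_mult clifford_mult_add)

lemma clifford_gen_relation:
  assumes "l \<in> {1..p + q}" "k \<in> {1..p + q}"
  shows "clifford_gen l \<otimes>\<^bsub>clifford p q\<^esub> clifford_gen k
      \<oplus>\<^bsub>clifford p q\<^esub> clifford_gen k \<otimes>\<^bsub>clifford p q\<^esub> clifford_gen l =
    (2 * (if l = k then 1 else 0) * clifford_eps p l) \<odot>\<^bsub>clifford p q\<^esub> \<one>\<^bsub>clifford p q\<^esub>"
proof -
  have "{l} \<subseteq> {1..p + q}" "{k} \<subseteq> {1..p + q}" using assms by auto
  then show ?thesis
    unfolding clifford_gen_def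
    by (auto simp: clifford_mult_indicator clifford_simps clifford_sign_def fun_eq_iff)
qed

lemma clifford_basis_eq:
  assumes "S \<subseteq> {1..p + q}"
  shows "clifford_basis p q S = (\<lambda>T. if T = S then 1 else 0)"
proof -
  have *: "foldr (\<lambda>k a. clifford_gen k \<otimes>\<^bsub>clifford p q\<^esub> a) xs \<one>\<^bsub>clifford p q\<^esub> =
      (\<lambda>T. if T = set xs then 1 else 0)"
    if "sorted_wrt (<) xs" "set xs \<subseteq> {1..p + q}" for xs
    using that
  proof (induction xs)
    case Nil
    then show ?case by (simp add: clifford_simps)
  next
    case (Cons k xs)
    have "k \<notin> set xs" using Cons.prems by auto
    then have "sym_diff {k} (set xs) = insert k (set xs)" by auto
    moreover have "clifford_sign p {k} (set xs) = 1"
      using Cons.prems by (auto simp: clifford_sign_def intro!: prod.neutral)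
    moreover have "{k} \<subseteq> {1..p + q}" "set xs \<subseteq> {1..p + q}" using Cons.prems by auto
    ultimately show ?case
      using Cons by (simp add: clifford_gen_def clifford_mult_indicator cong: if_cong)
  qed
  have "finite S" using assms finite_subset by blast
  then show ?thesis
    unfolding clifford_basis_def using assms by (subst *) auto
qed

lemma clifford_finsum:
  assumes "finite I" "\<And>i. i \<in> I \<Longrightarrow> a i \<in> carrier (clifford p q)"
  shows "(\<Oplus>\<^bsub>clifford p q\<^esub>i\<in>I. a i) = (\<lambda>S. \<Sum>i\<in>I. a i S)"
proof -
  interpret ring "clifford p q" by (rule clifford_ring)
  show ?thesis
    using assms
    by (induction I rule: finite_induct) (auto simp: clifford_simps(4,5) finsum_insert Pi_def)
qed

lemma clifford_basis_expansion:
  assumes "a \<in> carrier (clifford p q)"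
  shows "a = (\<Oplus>\<^bsub>clifford p q\<^esub>S\<in>Pow {1..p + q}. a S \<odot>\<^bsub>clifford p q\<^esub> clifford_basis p q S)"
proof -
  have "(\<Oplus>\<^bsub>clifford p q\<^esub>S\<in>Pow {1..p + q}. a S \<odot>\<^bsub>clifford p q\<^esub> clifford_basis p q S) =
    (\<lambda>T. \<Sum>S\<in>Pow {1..p + q}. (a S \<odot>\<^bsub>clifford p q\<^esub> clifford_basis p q S) T)"
    by (rule clifford_finsum) (auto simp: clifford_simps clifford_basis_eq)
  also have "\<dots> = (\<lambda>T. \<Sum>S\<in>Pow {1..p + q}. if S = T then a T else 0)"
    by (rule ext, rule sum.cong) (auto simp: clifford_simps clifford_basis_eq)
  also have "\<dots> = a"
    using assms by (auto simp: sum.delta clifford_simps fun_eq_iff)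
  finally show ?thesis ..
qed


section \<open>Densities, characteristic functions and convolution\<close>

definition clifford_integral :: "(real \<Rightarrow> multivector) \<Rightarrow> multivector" where
  "clifford_integral F = (\<lambda>S. LINT x|lebesgue. F x S)"

text \<open>For \<open>\<mu>\<^sup>2 = -1\<close> this is the exponential of \<open>\<mu> \<theta>\<close>.\<close>

definition clifford_exp :: "nat \<Rightarrow> nat \<Rightarrow> multivector \<Rightarrow> real \<Rightarrow> multivector" where
  "clifford_exp p q \<mu> \<theta> =
     cos \<theta> \<odot>\<^bsub>clifford p q\<^esub> \<one>\<^bsub>clifford p q\<^esub> \<oplus>\<^bsub>clifford p q\<^esub> sin \<theta> \<odot>\<^bsub>clifford p q\<^esub> \<mu>"

text \<open>
  The Bochner integral of a non-integrable function is zero, so total mass one includes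
  integrability.
\<close>

definition real_pdf :: "(real \<Rightarrow> real) \<Rightarrow> bool" where
  "real_pdf h \<longleftrightarrow>
     h \<in> borel_measurable lebesgue \<and> (\<forall>x. 0 \<le> h x) \<and> (LINT x|lebesgue. h x) = 1"

definition clifford_pdf :: "nat \<Rightarrow> nat \<Rightarrow> (real \<Rightarrow> multivector) \<Rightarrow> bool" where
  "clifford_pdf p q f \<longleftrightarrow>
     (\<forall>x. f x \<in> carrier (clifford p q)) \<and> (\<forall>S\<subseteq>{1..p + q}. real_pdf (\<lambda>x. f x S))"

definition clifford_char_fun ::
    "nat \<Rightarrow> nat \<Rightarrow> multivector \<Rightarrow> (real \<Rightarrow> multivector) \<Rightarrow> real \<Rightarrow> multivector" where
  "clifford_char_fun p q \<mu> f t =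
     clifford_integral (\<lambda>x. f x \<otimes>\<^bsub>clifford p q\<^esub> clifford_exp p q \<mu> (t * x))"

text \<open>
  The component at \<open>S\<close> of the characteristic function of \<open>g\<close> is the transform of the real
  coordinate of \<open>g\<close> at \<open>S\<close>. It is a multivector, not the real coordinate at \<open>S\<close> of the
  characteristic function.
\<close>

definition clifford_char_fun_component ::
    "nat \<Rightarrow> nat \<Rightarrow> multivector \<Rightarrow> (real \<Rightarrow> multivector) \<Rightarrow> nat set \<Rightarrow> real \<Rightarrow> multivector" where
  "clifford_char_fun_component p q \<mu> g S x =
     clifford_integral (\<lambda>t. g t S \<odot>\<^bsub>clifford p q\<^esub> clifford_exp p q \<mu> (t * x))"

definition clifford_convolution ::
    "nat \<Rightarrow> nat \<Rightarrow> (real \<Rightarrow> multivector) \<Rightarrow> (real \<Rightarrow> multivector) \<Rightarrow> real \<Rightarrow> multivector" where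
  "clifford_convolution p q f h y =
     clifford_integral (\<lambda>x. f x \<otimes>\<^bsub>clifford p q\<^esub> h (y - x))"

lemma clifford_exp_integrable:
  assumes "real_pdf h"
  shows "integrable lebesgue (\<lambda>t. h t * clifford_exp p q \<mu> (t * x) S)"
proof (rule Bochner_Integration.integrable_bound)
  have h: "integrable lebesgue h"
    using assms not_integrable_integral_eq [of lebesgue h] by (auto simp: real_pdf_def)
  then show "integrable lebesgue (\<lambda>t. h t * (1 + \<bar>\<mu> S\<bar>))" by simp
  have "continuous_on UNIV (\<lambda>t. clifford_exp p q \<mu> (t * x) S)"
    unfolding clifford_exp_def clifford_simps by (intro continuous_intros)
  then have "(\<lambda>t. clifford_exp p q \<mu> (t * x) S) \<in> borel_measurable lebesgue"
    by (simp add: borel_measurable_continuous_onI measurable_completion)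
  then show "(\<lambda>t. h t * clifford_exp p q \<mu> (t * x) S) \<in> borel_measurable lebesgue"
    using h by (intro borel_measurable_times) auto
  have "\<bar>clifford_exp p q \<mu> (t * x) S\<bar> \<le> 1 + \<bar>\<mu> S\<bar>" for t
  proof -
    have "\<bar>clifford_exp p q \<mu> (t * x) S\<bar> \<le> \<bar>cos (t * x)\<bar> * 1 + \<bar>sin (t * x)\<bar> * \<bar>\<mu> S\<bar>"
      unfolding clifford_exp_def clifford_simps
      by (rule order_trans [OF abs_triangle_ineq]) (auto simp: abs_mult)
    also have "\<dots> \<le> 1 * 1 + 1 * \<bar>\<mu> S\<bar>"
      by (intro add_mono mult_right_mono) auto
    finally show ?thesis by simp
  qed
  then show "AE t in lebesgue. norm (h t * clifford_exp p q \<mu> (t * x) S) \<le> norm (h t * (1 + \<bar>\<mu> S\<bar>))"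
    by (auto simp: abs_mult intro!: AE_I2 mult_left_mono)
qed

lemma clifford_char_fun_eq_components:
  assumes "clifford_pdf p q g" "\<mu> \<in> carrier (clifford p q)"
  shows "clifford_char_fun p q \<mu> g x =
    (\<Oplus>\<^bsub>clifford p q\<^esub>S\<in>Pow {1..p + q}.
       clifford_basis p q S \<otimes>\<^bsub>clifford p q\<^esub> clifford_char_fun_component p q \<mu> g S x)"
proof
  fix T
  let ?P = "Pow {1..p + q}"
  have int: "integrable lebesgue (\<lambda>t. g t A * clifford_exp p q \<mu> (t * x) B)" if "A \<in> ?P" for A B
    using that assms by (intro clifford_exp_integrable) (auto simp: clifford_pdf_def)
  have *: "(if Q then clifford_sign p A B * u * v else 0) =
      (if Q then clifford_sign p A B else 0) * (u * v)" for Q A B u v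
    by simp
  define sg where "sg A B = (if sym_diff A B = T then clifford_sign p A B else 0)" for A B
  have "clifford_char_fun p q \<mu> g x T =
      (LINT t|lebesgue. (\<Sum>A\<in>?P. \<Sum>B\<in>?P. sg A B * (g t A * clifford_exp p q \<mu> (t * x) B)))"
    unfolding clifford_char_fun_def clifford_integral_def clifford_simps(2) * sg_def
    by (simp only: mult.commute [of x])
  also have "\<dots> =
      (\<Sum>A\<in>?P. \<Sum>B\<in>?P. (LINT t|lebesgue. sg A B * (g t A * clifford_exp p q \<mu> (t * x) B)))"
    by (subst Bochner_Integration.integral_sum;
        (intro sum.cong refl Bochner_Integration.integral_sum)?;
        intro Bochner_Integration.integrable_sum integrable_mult_right int; assumption)
  also have "\<dots> = (\<Sum>A\<in>?P. \<Sum>B\<in>?P. sg A B * (LINT t|lebesgue. g t A * clifford_exp p q \<mu> (t * x) B))"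
    by simp
  also have "\<dots> = (\<Sum>A\<in>?P. \<Sum>B\<in>?P.
      (if sym_diff A B = T then clifford_sign p A B else 0) *
      clifford_char_fun_component p q \<mu> g A x B)"
    unfolding clifford_char_fun_component_def clifford_integral_def clifford_simps(6) sg_def
    by (simp only: mult.commute)
  also have "\<dots> = (\<Sum>A\<in>?P.
      (clifford_basis p q A \<otimes>\<^bsub>clifford p q\<^esub> clifford_char_fun_component p q \<mu> g A x) T)"
  proof (rule sum.cong [OF refl])
    fix A assume "A \<in> ?P"
    have "(clifford_basis p q A \<otimes>\<^bsub>clifford p q\<^esub> clifford_char_fun_component p q \<mu> g A x) T =
      (\<Sum>A'\<in>?P. \<Sum>B\<in>?P. if A' = A then (if sym_diff A B = T then clifford_sign p A B else 0) *
        clifford_char_fun_component p q \<mu> g A x B else 0)"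
      using \<open>A \<in> ?P\<close> unfolding clifford_simps
      by (intro sum.cong refl) (auto simp: clifford_basis_eq)
    also have "\<dots> = (\<Sum>B\<in>?P. \<Sum>A'\<in>?P. if A' = A then
        (if sym_diff A B = T then clifford_sign p A B else 0) *
        clifford_char_fun_component p q \<mu> g A x B else 0)"
      by (rule sum.swap)
    finally show "(\<Sum>B\<in>?P. (if sym_diff A B = T then clifford_sign p A B else 0) *
        clifford_char_fun_component p q \<mu> g A x B) =
      (clifford_basis p q A \<otimes>\<^bsub>clifford p q\<^esub> clifford_char_fun_component p q \<mu> g A x) T"
      using \<open>A \<in> ?P\<close> by (simp add: sum.delta)
  qed
  finally show "clifford_char_fun p q \<mu> g x T =
    (\<Oplus>\<^bsub>clifford p q\<^esub>S\<in>?P.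
       clifford_basis p q S \<otimes>\<^bsub>clifford p q\<^esub> clifford_char_fun_component p q \<mu> g S x) T"
    by (simp add: clifford_finsum clifford_mult_closed)
qed

end

(*
  Right multiplication by a constant commutes with the integral, so the factor e^{-mu t y} can be
  moved inside phi_X(t), where it merges with e^{mu t x} into e^{mu t (x - y)}. Expanding g_X(t) in
  the basis leaves real factors (g_X)_S(t), which commute with everything; only the basis elements
  stay on the left. The two sides then are the same iterated integrals in opposite orders, and
  Fubini's theorem applies to each coordinate since e^{mu theta} is bounded in theta.
*)
theory Submission
  imports Defs
begin

text \<open>Completion keeps the space and the measure of Borel sets, so a countable cover for
  \<open>lborel\<close> serves again. This makes Fubini available for
  \<open>lebesgue\<close>.\<close>

lemma sigma_finite_lebesgue: "sigma_finite_measure (lebesgue :: 'a::euclidean_space measure)"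
proof
  obtain A :: "'a set set" where "countable A" "A \<subseteq> sets lborel" "\<Union>A = space lborel"
      "\<forall>a\<in>A. emeasure lborel a \<noteq> \<infinity>"
    using lborel.sigma_finite_countable by blast
  then show "\<exists>A. countable A \<and> A \<subseteq> sets (lebesgue :: 'a measure) \<and> \<Union>A = space lebesgue \<and>
      (\<forall>a\<in>A. emeasure lebesgue a \<noteq> \<infinity>)"
    by (intro exI [of _ A]) (auto simp: subset_iff)
qed

text \<open>With the sign split off as a constant, linearity of integrals applies to products
  directly.\<close>

lemma clifford_mult_apply:
  "(a \<otimes>\<^bsub>clifford p q\<^esub> b) S = (\<Sum>A\<in>Pow {1..p + q}. \<Sum>B\<in>Pow {1..p + q}.
     (if sym_diff A B = S then clifford_sign p A B else 0) * (a A * b B))"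
  unfolding clifford_simps by (intro sum.cong refl) auto

lemma clifford_minus_one: "\<ominus>\<^bsub>clifford p q\<^esub> \<one>\<^bsub>clifford p q\<^esub> = (\<lambda>S. if S = {} then - 1 else 0)"
proof -
  interpret ring "clifford p q" by (rule clifford_ring)
  show ?thesis
    by (rule minus_equality) (auto simp: clifford_simps)
qed

lemma clifford_exp_apply:
  "clifford_exp p q \<mu> \<theta> S = cos \<theta> * (if S = {} then 1 else 0) + sin \<theta> * \<mu> S"
  by (simp add: clifford_exp_def clifford_simps)

text \<open>Uniformity in \<open>\<theta>\<close> is the point: the bound supplies the dominating
  function for Fubini.\<close>

lemma abs_clifford_exp_le: "\<bar>clifford_exp p q \<mu> \<theta> S\<bar> \<le> 1 + \<bar>\<mu> S\<bar>"
proof -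
  have "\<bar>clifford_exp p q \<mu> \<theta> S\<bar> \<le> \<bar>cos \<theta>\<bar> * 1 + \<bar>sin \<theta>\<bar> * \<bar>\<mu> S\<bar>"
    unfolding clifford_exp_apply by (rule order_trans [OF abs_triangle_ineq]) (auto simp: abs_mult)
  also have "\<dots> \<le> 1 * 1 + 1 * \<bar>\<mu> S\<bar>"
    by (intro add_mono mult_right_mono) auto
  finally show ?thesis by simp
qed

text \<open>Expanding bilinearly, \<open>\<mu>\<close> squared to -1 turns the coefficients of 1 and
  \<open>\<mu>\<close> into the addition formulas for cosine and sine.\<close>

lemma clifford_exp_add:
  assumes "\<mu> \<in> carrier (clifford p q)"
    and "\<mu> \<otimes>\<^bsub>clifford p q\<^esub> \<mu> = \<ominus>\<^bsub>clifford p q\<^esub> \<one>\<^bsub>clifford p q\<^esub>"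
  shows "clifford_exp p q \<mu> s \<otimes>\<^bsub>clifford p q\<^esub> clifford_exp p q \<mu> t = clifford_exp p q \<mu> (s + t)"
proof -
  interpret ring "clifford p q" by (rule clifford_ring)
  have "clifford_exp p q \<mu> s \<otimes>\<^bsub>clifford p q\<^esub> clifford_exp p q \<mu> t =
      cos t \<odot>\<^bsub>clifford p q\<^esub> (cos s \<odot>\<^bsub>clifford p q\<^esub> \<one>\<^bsub>clifford p q\<^esub> \<oplus>\<^bsub>clifford p q\<^esub> sin s \<odot>\<^bsub>clifford p q\<^esub> \<mu>) \<oplus>\<^bsub>clifford p q\<^esub>
      sin t \<odot>\<^bsub>clifford p q\<^esub> (cos s \<odot>\<^bsub>clifford p q\<^esub> \<mu> \<oplus>\<^bsub>clifford p q\<^esub> sin s \<odot>\<^bsub>clifford p q\<^esub> (\<ominus>\<^bsub>clifford p q\<^esub> \<one>\<^bsub>clifford p q\<^esub>))"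
    using assms unfolding clifford_exp_def
    by (simp add: clifford_add_mult clifford_mult_add clifford_smult_mult clifford_mult_smult)
  also have "\<dots> = clifford_exp p q \<mu> (s + t)"
    unfolding clifford_minus_one
    by (rule ext) (simp add: clifford_exp_def clifford_simps cos_add sin_add algebra_simps)
  finally show ?thesis .
qed

lemma integrable_const_clifford_mult:
  assumes "\<And>S. integrable lebesgue (\<lambda>x. F x S)"
  shows "integrable lebesgue (\<lambda>x. (a \<otimes>\<^bsub>clifford p q\<^esub> F x) S)"
  unfolding clifford_mult_apply
  by (intro Bochner_Integration.integrable_sum integrable_mult_right assms)

text \<open>Coordinates of the product are finite linear combinations of those of
  \<open>F x\<close>. The product is not commutative, so left and right factors get separate rules:
  this one absorbs the outer exponential, the next extracts \<open>f x\<close> and the basis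
  elements.\<close>

lemma clifford_integral_mult_const:
  assumes "\<And>S. integrable lebesgue (\<lambda>x. F x S)"
  shows "clifford_integral (\<lambda>x. F x \<otimes>\<^bsub>clifford p q\<^esub> a) = clifford_integral F \<otimes>\<^bsub>clifford p q\<^esub> a"
  by (rule ext) (simp add: clifford_integral_def clifford_mult_apply assms)

lemma clifford_integral_const_mult:
  assumes "\<And>S. integrable lebesgue (\<lambda>x. F x S)"
  shows "clifford_integral (\<lambda>x. a \<otimes>\<^bsub>clifford p q\<^esub> F x) = a \<otimes>\<^bsub>clifford p q\<^esub> clifford_integral F"
  by (rule ext) (simp add: clifford_integral_def clifford_mult_apply assms)

lemma clifford_integral_smult:
  "clifford_integral (\<lambda>x. r \<odot>\<^bsub>clifford p q\<^esub> F x) = r \<odot>\<^bsub>clifford p q\<^esub> clifford_integral F"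
  by (rule ext) (simp add: clifford_integral_def clifford_simps)

text \<open>Values in the carrier make the ring sum coordinatewise (\<open>clifford_finsum\<close>);
  linearity in each coordinate does the rest.\<close>

lemma clifford_integral_finsum:
  assumes "finite I" "\<And>i x. i \<in> I \<Longrightarrow> F i x \<in> carrier (clifford p q)"
    and "\<And>i S. i \<in> I \<Longrightarrow> integrable lebesgue (\<lambda>x. F i x S)"
  shows "clifford_integral (\<lambda>x. \<Oplus>\<^bsub>clifford p q\<^esub>i\<in>I. F i x) =
    (\<Oplus>\<^bsub>clifford p q\<^esub>i\<in>I. clifford_integral (F i))"
proof -
  have "clifford_integral (F i) \<in> carrier (clifford p q)" if "i \<in> I" for i
    using assms(2) [OF that] by (auto simp: clifford_integral_def clifford_simps)
  then show ?thesis
    using assms by (simp add: clifford_finsum clifford_integral_def)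
qed

text \<open>Real scalars are central, so the coordinate \<open>a S\<close> can be shifted onto
  \<open>b\<close>, leaving only a constant basis element on the left.\<close>

lemma clifford_mult_basis_expansion:
  assumes "a \<in> carrier (clifford p q)" "b \<in> carrier (clifford p q)"
  shows "a \<otimes>\<^bsub>clifford p q\<^esub> b = (\<Oplus>\<^bsub>clifford p q\<^esub>S\<in>Pow {1..p + q}.
    clifford_basis p q S \<otimes>\<^bsub>clifford p q\<^esub> (a S \<odot>\<^bsub>clifford p q\<^esub> b))"
proof -
  interpret ring "clifford p q" by (rule clifford_ring)
  have "a \<otimes>\<^bsub>clifford p q\<^esub> b =
      (\<Oplus>\<^bsub>clifford p q\<^esub>S\<in>Pow {1..p + q}. a S \<odot>\<^bsub>clifford p q\<^esub> clifford_basis p q S) \<otimes>\<^bsub>clifford p q\<^esub> b"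
    using clifford_basis_expansion [OF assms(1)] by simp
  also have "\<dots> = (\<Oplus>\<^bsub>clifford p q\<^esub>S\<in>Pow {1..p + q}.
      (a S \<odot>\<^bsub>clifford p q\<^esub> clifford_basis p q S) \<otimes>\<^bsub>clifford p q\<^esub> b)"
    using assms(2) by (intro finsum_ldistr) (auto simp: clifford_simps clifford_basis_eq)
  finally show ?thesis by (simp only: clifford_smult_mult clifford_mult_smult)
qed

lemma real_pdf_integrable: "real_pdf h \<Longrightarrow> integrable lebesgue h"
  using not_integrable_integral_eq [of lebesgue h] by (auto simp: real_pdf_def)

text \<open>Coordinates are densities inside the index range and identically zero outside
  it.\<close>

lemma clifford_pdf_integrable:
  assumes "clifford_pdf p q f"
  shows "integrable lebesgue (\<lambda>x. f x S)"
  using assms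
  by (cases "S \<subseteq> {1..p + q}") (auto simp: clifford_pdf_def clifford_simps intro: real_pdf_integrable)

lemma clifford_pdf_exp_integrable:
  assumes "clifford_pdf p q f"
  shows "integrable lebesgue (\<lambda>x. (f x \<otimes>\<^bsub>clifford p q\<^esub> clifford_exp p q \<mu> (t * x)) S)"
proof -
  have "integrable lebesgue (\<lambda>x. f x A * clifford_exp p q \<mu> (t * x) B)" if "A \<subseteq> {1..p + q}" for A B
    using that assms clifford_exp_integrable [of "\<lambda>x. f x A" p q \<mu> t B]
    by (simp add: clifford_pdf_def mult.commute)
  then show ?thesis
    unfolding clifford_mult_apply
    by (intro Bochner_Integration.integrable_sum integrable_mult_right) auto
qed

lemma integrable_pair_clifford_exp:
  assumes h: "integrable lebesgue h" and k: "integrable lebesgue k"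
  shows "integrable (lebesgue \<Otimes>\<^sub>M lebesgue)
    (\<lambda>(t, x). h t * k x * clifford_exp p q \<mu> (t * (x - y)) S)"
proof -
  interpret sigma_finite_measure "lebesgue :: real measure" by (rule sigma_finite_lebesgue)
  interpret pair_sigma_finite "lebesgue :: real measure" "lebesgue :: real measure" ..
  have [measurable]: "h \<in> borel_measurable lebesgue" "k \<in> borel_measurable lebesgue"
    using h k by auto
  \<comment> \<open>The densities are only Lebesgue measurable, so the arguments of cosine and sine
    must also be measurable from the completed measure.\<close>
  have [measurable]: "(\<lambda>x. x) \<in> borel_measurable (lebesgue :: real measure)"
    by (simp add: measurable_completion)
  \<comment> \<open>Tonelli's criterion: the inner integral of the absolute value is
    \<open>\<bar>h t\<bar>\<close> times the finite integral of
    \<open>\<bar>k\<bar>\<close>.\<close>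
  have "integrable (lebesgue \<Otimes>\<^sub>M lebesgue) (\<lambda>z. h (fst z) * k (snd z))"
    by (rule Fubini_integrable) (use h k in \<open>auto simp: abs_mult\<close>)
  then have "integrable (lebesgue \<Otimes>\<^sub>M lebesgue) (\<lambda>z. h (fst z) * k (snd z) * (1 + \<bar>\<mu> S\<bar>))"
    by simp
  then show ?thesis
  proof (rule Bochner_Integration.integrable_bound)
    show "(\<lambda>(t, x). h t * k x * clifford_exp p q \<mu> (t * (x - y)) S)
        \<in> borel_measurable (lebesgue \<Otimes>\<^sub>M lebesgue)"
      unfolding clifford_exp_apply by measurable
    show "AE z in lebesgue \<Otimes>\<^sub>M lebesgue.
        norm (case z of (t, x) \<Rightarrow> h t * k x * clifford_exp p q \<mu> (t * (x - y)) S)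
        \<le> norm (h (fst z) * k (snd z) * (1 + \<bar>\<mu> S\<bar>))"
      by (auto simp: abs_mult intro!: AE_I2 mult_left_mono abs_clifford_exp_le)
  qed
qed

text \<open>Each coordinate is a finite combination, with constant signs, of integrands covered by
  \<open>integrable_pair_clifford_exp\<close>.\<close>

lemma integrable_pair_clifford_pdf_exp:
  assumes "integrable lebesgue h" "clifford_pdf p q f"
  shows "integrable (lebesgue \<Otimes>\<^sub>M lebesgue)
    (\<lambda>(t, x). (h t \<odot>\<^bsub>clifford p q\<^esub>
      (f x \<otimes>\<^bsub>clifford p q\<^esub> clifford_exp p q \<mu> (t * (x - y)))) S)"
proof -
  have "(\<lambda>(t, x). (h t \<odot>\<^bsub>clifford p q\<^esub>
      (f x \<otimes>\<^bsub>clifford p q\<^esub> clifford_exp p q \<mu> (t * (x - y)))) S) =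
    (\<lambda>z. \<Sum>A\<in>Pow {1..p + q}. \<Sum>B\<in>Pow {1..p + q}.
      (if sym_diff A B = S then clifford_sign p A B else 0) *
      (case z of (t, x) \<Rightarrow> h t * f x A * clifford_exp p q \<mu> (t * (x - y)) B))"
    by (auto simp: clifford_simps(6) clifford_mult_apply sum_distrib_left fun_eq_iff ac_simps
        intro!: sum.cong)
  then show ?thesis
    by (simp only:)
       (intro Bochner_Integration.integrable_sum integrable_mult_right
         integrable_pair_clifford_exp assms(1) clifford_pdf_integrable [OF assms(2)])
qed

theorem theorem4p4:
  fixes p q :: nat and \<mu> :: multivector and f g :: "real \<Rightarrow> multivector" and y :: real
  assumes "\<mu> \<in> carrier (clifford p q)"
    and "\<mu> \<otimes>\<^bsub>clifford p q\<^esub> \<mu> = \<ominus>\<^bsub>clifford p q\<^esub> \<one>\<^bsub>clifford p q\<^esub>"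
    and "clifford_pdf p q f"
    and "clifford_pdf p q g"
  shows "clifford_integral
           (\<lambda>t. g t \<otimes>\<^bsub>clifford p q\<^esub> clifford_char_fun p q \<mu> f t
                  \<otimes>\<^bsub>clifford p q\<^esub> clifford_exp p q \<mu> (- (t * y))) =
         (\<Oplus>\<^bsub>clifford p q\<^esub>S\<in>Pow {1..p + q}.
            clifford_basis p q S \<otimes>\<^bsub>clifford p q\<^esub>
            clifford_convolution p q f (\<lambda>x. clifford_char_fun_component p q \<mu> g S (- x)) y)"
proof -
  interpret sigma_finite_measure "lebesgue :: real measure" by (rule sigma_finite_lebesgue)
  interpret pair_sigma_finite "lebesgue :: real measure" "lebesgue :: real measure" ..
  define E where "E = clifford_exp p q \<mu>"
  \<comment> \<open>The double integrand shared by both sides once the basis element is stripped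
    off.\<close>
  define H where "H S t x = g t S \<odot>\<^bsub>clifford p q\<^esub> (f x \<otimes>\<^bsub>clifford p q\<^esub> E (t * (x - y)))" for S t x
  have H_int: "integrable (lebesgue \<Otimes>\<^sub>M lebesgue) (\<lambda>(t, x). H S t x T)" for S T
    unfolding H_def E_def
    by (rule integrable_pair_clifford_pdf_exp [OF clifford_pdf_integrable [OF assms(4)] assms(3)])
  \<comment> \<open>Needed at the end to take the finite sum and the basis elements out of the outer
    integral.\<close>
  have H_int_fst: "integrable lebesgue (\<lambda>t. clifford_integral (H S t) T)" for S T
    using integrable_fst' [OF H_int [of S T]] by (simp add: clifford_integral_def)
  have left: "g t \<otimes>\<^bsub>clifford p q\<^esub> clifford_char_fun p q \<mu> f t \<otimes>\<^bsub>clifford p q\<^esub> E (- (t * y)) =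
      (\<Oplus>\<^bsub>clifford p q\<^esub>S\<in>Pow {1..p + q}.
        clifford_basis p q S \<otimes>\<^bsub>clifford p q\<^esub> clifford_integral (H S t))" for t
  proof -
    have *: "clifford_char_fun p q \<mu> f t \<otimes>\<^bsub>clifford p q\<^esub> E (- (t * y)) =
        clifford_integral (\<lambda>x. f x \<otimes>\<^bsub>clifford p q\<^esub> E (t * (x - y)))"
      unfolding clifford_char_fun_def E_def
      by (subst clifford_integral_mult_const [symmetric])
         (simp_all add: clifford_pdf_exp_integrable assms clifford_mult_assoc
           clifford_exp_add [OF assms(1,2)] right_diff_distrib)
    have "g t \<in> carrier (clifford p q)"
      using assms(4) by (simp add: clifford_pdf_def)
    \<comment> \<open>Here \<open>b\<close> is the whole product of the characteristic function and
      the exponential; the scalar \<open>g t S\<close> then enters the integral over x.\<close>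
    from clifford_mult_basis_expansion [OF this clifford_mult_closed]
    show ?thesis
      unfolding clifford_mult_assoc H_def clifford_integral_smult * [symmetric] .
  qed
  have right: "clifford_integral (\<lambda>t. clifford_integral (H S t)) =
      clifford_convolution p q f (\<lambda>x. clifford_char_fun_component p q \<mu> g S (- x)) y"
    if "S \<subseteq> {1..p + q}" for S
  proof -
    \<comment> \<open>Only for \<open>S\<close> in the index range is this coordinate a
      density.\<close>
    have "real_pdf (\<lambda>t. g t S)"
      using assms(4) that by (simp add: clifford_pdf_def)
    then have g_int: "integrable lebesgue (\<lambda>t. (g t S \<odot>\<^bsub>clifford p q\<^esub> E (t * z)) T)" for z T
      unfolding E_def clifford_simps(6) by (rule clifford_exp_integrable)
    have "clifford_integral (\<lambda>t. clifford_integral (H S t)) =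
        clifford_integral (\<lambda>x. clifford_integral (\<lambda>t. H S t x))"
      unfolding clifford_integral_def by (rule ext, rule Fubini_integral [OF H_int, symmetric])
    \<comment> \<open>The real factor \<open>g t S\<close> passes to the right of
      \<open>f x\<close>, which is constant in t and leaves the inner integral on the left, as the
      order in the convolution demands.\<close>
    also have "\<dots> = clifford_integral (\<lambda>x. f x \<otimes>\<^bsub>clifford p q\<^esub>
        clifford_integral (\<lambda>t. g t S \<odot>\<^bsub>clifford p q\<^esub> E (t * (x - y))))"
      unfolding H_def clifford_mult_smult [symmetric]
      by (simp only: clifford_integral_const_mult [OF g_int])
    \<comment> \<open>The reflection enters here: the convolution evaluates the component at -(y -
      x) = x - y.\<close>
    finally show ?thesis
      by (simp add: clifford_convolution_def clifford_char_fun_component_def E_def right_diff_distrib)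
  qed
  have "clifford_integral (\<lambda>t. \<Oplus>\<^bsub>clifford p q\<^esub>S\<in>Pow {1..p + q}.
        clifford_basis p q S \<otimes>\<^bsub>clifford p q\<^esub> clifford_integral (H S t)) =
      (\<Oplus>\<^bsub>clifford p q\<^esub>S\<in>Pow {1..p + q}.
        clifford_basis p q S \<otimes>\<^bsub>clifford p q\<^esub> clifford_integral (\<lambda>t. clifford_integral (H S t)))"
    by (simp add: clifford_integral_finsum clifford_mult_closed integrable_const_clifford_mult
        H_int_fst clifford_integral_const_mult)
  also have "\<dots> = (\<Oplus>\<^bsub>clifford p q\<^esub>S\<in>Pow {1..p + q}. clifford_basis p q S \<otimes>\<^bsub>clifford p q\<^esub>
      clifford_convolution p q f (\<lambda>x. clifford_char_fun_component p q \<mu> g S (- x)) y)"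
    by (simp add: right clifford_finsum clifford_mult_closed)
  finally show ?thesis
    by (simp only: left [unfolded E_def])
qed

end
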